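(* (a) For every $\gamma\in(0,\tfrac12]$ and $\delta\in[0,\tfrac12]$ there is a constant $C=C(\gamma,\delta)>0$ such that the following holds. Let $G,R>0$, let $d\ge1$, let $X\subseteq\mathbb{R}^d$ be nonempty closed convex, and let $f:\mathbb{R}^d\to\mathbb{R}$ be convex, with a minimizer $x^*\in\operatorname{argmin}_{x\in X}f(x)$, and such that $\|g\|\le G$ for all $x\in X$, $g\in\partial f(x)$. Let $N\ge1$ be an integer, $x^1\in X$ with $\|x^1-x^*\|\le R$, and let $x^1,\dots,x^{N+1}$, $g^1,\dots,g^N$ be generated by $N$ iterations of AdaGrad with parameter $h=R/N^{\gamma}$ from $x^1$, such that $$G^2+\sum_{i=1}^{N-1}\|g^i\|^2=G^2N^{2\delta}.$$ Then $$f(x^{N+1})-f(x^* )\le\begin{cases} C\,GR\,N^{-\gamma-\delta}\left(1+\log(N^{2\delta})\right), & 0<\gamma+\delta\le\frac12,\\[2pt] C\,GR\,N^{\gamma+\delta-1}, & \frac12<\gamma+\delta\le1.\end{cases}$$ (b) In particular, for every $\gamma\in(0,\tfrac12]$ there is a constant $C'=C'(\gamma)>0$ such that for all $G,R>0$ and all integers $N\ge1$ there exist $X$, $f$, $x^*$, $x^1$ satisfying the assumptions listed in (a) and a run of $N$ iterations of AdaGrad with parameter $h=R/N^{\gamma}$ for which $$G^2+\sum_{i=1}^{N-1}\|g^i\|^2=G^2N^{2\delta}\quad\text{with}\quad \delta=\tfrac12\left\lfloor\gamma+\tfrac34\right\rfloor,$$ and consequently $$f(x^{N+1})-f(x^*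 )\le C'\max\left\{\frac{GR}{N^{\gamma}},\frac{GR}{N^{\frac12-\gamma}}\right\}.$$ The quantity $\max\{GR/N^{\gamma},\,GR/N^{\frac12-\gamma}\}$ is minimized over $\gamma\in(0,\frac12]$ at $\gamma=\frac14$, in which case the bound reads $f(x^{N+1})-f(x^* )\le C'\,GR/N^{1/4}$.
   Context: $\|\cdot\|$ is the Euclidean norm on $\mathbb{R}^d$, $\partial f(x)=\{g\in\mathbb{R}^d: f(y)\ge f(x)+\langle g,y-x\rangle\ \forall y\in\mathbb{R}^d\}$, and $P_X(y)=\operatorname{argmin}_{x\in X}\|x-y\|$ is the Euclidean projection onto $X$. $\log$ is the natural logarithm. AdaGrad (scalar stepsizes) with parameter $h>0$, run for $N$ iterations from $x^1\in X$: for $k=1,\dots,N$, receive some (arbitrarily selected) $g^k\in\partial f(x^k)$ and set $$x^{k+1}=P_X(x^k-h_kg^k),\qquad h_k=\frac{h}{\sqrt{G^2+\sum_{i=1}^{k}\|g^i\|^2}}.$$ The last iterate is $x^{N+1}$. For $N\ge2$ the number $\delta$ is determined by the run: $\delta=\frac12\log_N\bigl(1+\sum_{i=1}^{N-1}\|g^i\|^2/G^2\bigr)\in[0,\frac12]$. *)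

theory Defs
  imports "HOL-Analysis.Analysis"
begin

text \<open>
  The constants in the theorem do not depend on the dimension \<open>d\<close>, so \<open>d\<close> has to be quantified
  inside the formula and cannot be an index type. All the spaces \<open>\<real>\<^sup>d\<close> therefore live in one inner
  product space, the finitely supported real sequences, and \<open>Rd d\<close> consists of the sequences that
  vanish outside \<open>{..<d}\<close>. On \<open>Rd d\<close> the inner product is the Euclidean one, see
  \<open>inner_Rd\<close>, \<open>norm_Rd\<close> and \<open>range_of_coords\<close> below. As \<open>Rd d\<close> is closed (\<open>closed_Rd\<close>), a subset
  of it is closed in the ambient space iff it is closed in \<open>\<real>\<^sup>d\<close>.
\<close>

typedef fseq = "{x :: nat \<Rightarrow> real. finite {i. x i \<noteq> 0}}"
  morphisms coord Fseq
  by (rule exI[of _ "\<lambda>_. 0"]) simp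

lemma finite_supp: "finite {i. coord x i \<noteq> 0}"
  using coord[of x] by simp

lemma fseq_eqI: "(\<And>i. coord x i = coord y i) \<Longrightarrow> x = y"
  by (simp add: coord_inject[symmetric] fun_eq_iff)

instantiation fseq :: real_vector
begin

definition zero_fseq :: fseq
  where "0 = Fseq (\<lambda>_. 0)"

definition plus_fseq :: "fseq \<Rightarrow> fseq \<Rightarrow> fseq"
  where "x + y = Fseq (\<lambda>i. coord x i + coord y i)"

definition uminus_fseq :: "fseq \<Rightarrow> fseq"
  where "- x = Fseq (\<lambda>i. - coord x i)"

definition minus_fseq :: "fseq \<Rightarrow> fseq \<Rightarrow> fseq"
  where "x - y = Fseq (\<lambda>i. coord x i - coord y i)"

definition scaleR_fseq :: "real \<Rightarrow> fseq \<Rightarrow> fseq"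
  where "c *\<^sub>R x = Fseq (\<lambda>i. c * coord x i)"

lemma coord_Fseq:
  assumes "{i. a i \<noteq> 0} \<subseteq> {i. coord x i \<noteq> 0} \<union> {i. coord y i \<noteq> 0}"
  shows "coord (Fseq a) = a"
  using finite_subset[OF assms] by (simp add: Fseq_inverse finite_supp)

lemma coord_simps [simp]:
  "coord 0 i = 0" "coord (x + y) i = coord x i + coord y i" "coord (- x) i = - coord x i"
  "coord (x - y) i = coord x i - coord y i" "coord (c *\<^sub>R x) i = c * coord x i"
  unfolding zero_fseq_def plus_fseq_def uminus_fseq_def minus_fseq_def scaleR_fseq_def
  by (subst coord_Fseq[of _ x y]; auto)+

instance
proof
  fix x y z :: fseq and a b :: real
  show "x + y + z = x + (y + z)" by (rule fseq_eqI) (simp only: coord_simps add.assoc)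
  show "x + y = y + x" by (rule fseq_eqI) (simp only: coord_simps add.commute)
  show "0 + x = x" by (rule fseq_eqI) (simp only: coord_simps add_0)
  show "- x + x = 0" by (rule fseq_eqI) (simp only: coord_simps left_minus)
  show "x - y = x + - y" by (rule fseq_eqI) (simp only: coord_simps diff_conv_add_uminus)
  show "a *\<^sub>R (x + y) = a *\<^sub>R x + a *\<^sub>R y"
    by (rule fseq_eqI) (simp only: coord_simps distrib_left)
  show "(a + b) *\<^sub>R x = a *\<^sub>R x + b *\<^sub>R x"
    by (rule fseq_eqI) (simp only: coord_simps distrib_right)
  show "a *\<^sub>R b *\<^sub>R x = (a * b) *\<^sub>R x"
    by (rule fseq_eqI) (simp only: coord_simps mult.assoc)
  show "1 *\<^sub>R x = x" by (rule fseq_eqI) (simp only: coord_simps mult_1)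
qed

end

instantiation fseq :: real_inner
begin

definition inner_fseq :: "fseq \<Rightarrow> fseq \<Rightarrow> real"
  where "inner_fseq x y = (\<Sum>i | coord x i \<noteq> 0. coord x i * coord y i)"

definition norm_fseq :: "fseq \<Rightarrow> real"
  where "norm_fseq x = sqrt (inner x x)"

definition sgn_fseq :: "fseq \<Rightarrow> fseq"
  where "sgn_fseq x = x /\<^sub>R norm x"

definition dist_fseq :: "fseq \<Rightarrow> fseq \<Rightarrow> real"
  where "dist_fseq x y = norm (x - y)"

definition uniformity_fseq :: "(fseq \<times> fseq) filter"
  where "uniformity_fseq = (INF e\<in>{0 <..}. principal {(x, y). dist x y < e})"

definition open_fseq :: "fseq set \<Rightarrow> bool"
  where "open_fseq U \<longleftrightarrow> (\<forall>x\<in>U. eventually (\<lambda>(x', y). x' = x \<longrightarrow> y \<in> U) uniformity)"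

lemma inner_fseq_superset:
  assumes "finite A" "{i. coord x i \<noteq> 0} \<subseteq> A"
  shows "inner x y = (\<Sum>i\<in>A. coord x i * coord y i)"
  unfolding inner_fseq_def by (rule sum.mono_neutral_left) (use assms in auto)

instance
proof
  fix x y z :: fseq and r :: real
  let ?A = "{i. coord x i \<noteq> 0} \<union> {i. coord y i \<noteq> 0}"
  have fA: "finite ?A" by (simp add: finite_supp)
  have ex: "inner x w = (\<Sum>i\<in>?A. coord x i * coord w i)"
    and ey: "inner y w = (\<Sum>i\<in>?A. coord y i * coord w i)" for w
    by (rule inner_fseq_superset[OF fA]; auto)+
  show "inner x y = inner y x"
    unfolding ex ey by (simp add: mult.commute)
  have "inner (x + y) z = (\<Sum>i\<in>?A. coord (x + y) i * coord z i)"
    by (rule inner_fseq_superset[OF fA]) auto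
  then show "inner (x + y) z = inner x z + inner y z"
    unfolding ex ey by (simp add: algebra_simps sum.distrib)
  have "inner (r *\<^sub>R x) y = (\<Sum>i\<in>?A. coord (r *\<^sub>R x) i * coord y i)"
    by (rule inner_fseq_superset[OF fA]) auto
  then show "inner (r *\<^sub>R x) y = r * inner x y"
    unfolding ex by (simp add: sum_distrib_left mult.assoc)
  show "0 \<le> inner x x"
    unfolding inner_fseq_def by (rule sum_nonneg) simp
  have "inner x x = 0 \<longleftrightarrow> (\<forall>i\<in>{i. coord x i \<noteq> 0}. coord x i * coord x i = 0)"
    unfolding inner_fseq_def by (rule sum_nonneg_eq_0_iff) (auto simp: finite_supp)
  also have "\<dots> \<longleftrightarrow> x = 0"
    by (auto intro: fseq_eqI)
  finally show "inner x x = 0 \<longleftrightarrow> x = 0" .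
qed (fact norm_fseq_def sgn_fseq_def dist_fseq_def uniformity_fseq_def open_fseq_def)+

end

definition Rd :: "nat \<Rightarrow> fseq set"
  where "Rd d = {x. \<forall>i\<ge>d. coord x i = 0}"

lemma inner_Rd:
  assumes "x \<in> Rd d"
  shows "inner x y = (\<Sum>i<d. coord x i * coord y i)"
proof (rule inner_fseq_superset)
  show "{i. coord x i \<noteq> 0} \<subseteq> {..<d}"
    using assms leI unfolding Rd_def by blast
qed simp

lemma norm_Rd:
  assumes "x \<in> Rd d"
  shows "norm x = sqrt (\<Sum>i<d. (coord x i)\<^sup>2)"
  using inner_Rd[OF assms, of x] by (simp add: norm_fseq_def power2_eq_square)

lemma range_of_coords: "\<exists>!x. x \<in> Rd d \<and> (\<forall>i<d. coord x i = a i)"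
proof -
  define e where "e = Fseq (\<lambda>i. if i < d then a i else 0)"
  have "finite {i. (if i < d then a i else 0) \<noteq> 0}"
    by (rule finite_subset[of _ "{..<d}"]) auto
  then have e: "coord e i = (if i < d then a i else 0)" for i
    unfolding e_def by (subst Fseq_inverse) simp_all
  show ?thesis
  proof (rule ex1I[of _ e])
    show "e \<in> Rd d \<and> (\<forall>i<d. coord e i = a i)"
      by (simp add: Rd_def e)
  next
    fix x assume x: "x \<in> Rd d \<and> (\<forall>i<d. coord x i = a i)"
    show "x = e"
    proof (rule fseq_eqI)
      show "coord x i = coord e i" for i
        using x by (cases "i < d") (simp_all add: Rd_def e)
    qed
  qed
qed

lemma subspace_Rd: "subspace (Rd d)"
  by (auto simp: subspace_def Rd_def)

lemma closed_Rd: "closed (Rd d)"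
proof -
  have single: "\<exists>e. \<forall>x. coord x i = inner e x" for i
  proof -
    obtain e where e: "e \<in> Rd (Suc i)" "\<forall>j<Suc i. coord e j = (if j = i then 1 else 0)"
      using range_of_coords[of "Suc i" "\<lambda>j. if j = i then 1 else 0"] by blast
    have "inner e x = (\<Sum>j<Suc i. if j = i then coord x j else 0)" for x
      unfolding inner_Rd[OF e(1)] by (rule sum.cong) (use e(2) in auto)
    then have "\<forall>x. coord x i = inner e x" by simp
    then show ?thesis by blast
  qed
  have "closed {x. coord x i = 0}" for i
  proof -
    obtain e where "\<forall>x. coord x i = inner e x" using single by blast
    then show ?thesis by (simp add: closed_hyperplane)
  qed
  then have "closed (\<Inter>i\<in>{d..}. {x. coord x i = 0})" by auto
  also have "(\<Inter>i\<in>{d..}. {x. coord x i = 0}) = Rd d" by (auto simp: Rd_def)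
  finally show ?thesis .
qed

text \<open>
  In the following, \<open>E\<close> is the Euclidean space in question; a function on \<open>E\<close> is given as a
  function on the ambient type, whose values outside \<open>E\<close> are irrelevant.
\<close>

definition subdifferential :: "'a::real_inner set \<Rightarrow> ('a \<Rightarrow> real) \<Rightarrow> 'a \<Rightarrow> 'a set"
  where "subdifferential E f x = {g \<in> E. \<forall>y\<in>E. f y \<ge> f x + inner g (y - x)}"

definition proj :: "'a::real_inner set \<Rightarrow> 'a \<Rightarrow> 'a"
  where "proj X y = arg_min_on (\<lambda>x. norm (x - y)) X"

definition adagrad_step :: "real \<Rightarrow> real \<Rightarrow> (nat \<Rightarrow> 'a::real_inner) \<Rightarrow> nat \<Rightarrow> real"
  where "adagrad_step h G g k = h / sqrt (G\<^sup>2 + (\<Sum>i=1..k. (norm (g i))\<^sup>2))"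

text \<open>
  Iterates and subgradients are indexed from \<open>1\<close>; only \<open>x 1, \<dots>, x (N + 1)\<close> and \<open>g 1, \<dots>, g N\<close>
  are constrained. The choice of each subgradient is arbitrary.
\<close>

definition adagrad_run ::
  "'a::real_inner set \<Rightarrow> 'a set \<Rightarrow> ('a \<Rightarrow> real) \<Rightarrow> real \<Rightarrow> real \<Rightarrow> nat \<Rightarrow> (nat \<Rightarrow> 'a) \<Rightarrow> (nat \<Rightarrow> 'a) \<Rightarrow> bool"
  where "adagrad_run E X f G h N x g \<longleftrightarrow>
    x 1 \<in> X \<and>
    (\<forall>k\<in>{1..N}. g k \<in> subdifferential E f (x k) \<and>
                x (k + 1) = proj X (x k - adagrad_step h G g k *\<^sub>R g k))"

definition convex_problem ::
  "'a::real_inner set \<Rightarrow> 'a set \<Rightarrow> ('a \<Rightarrow> real) \<Rightarrow> 'a \<Rightarrow> real \<Rightarrow> bool"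
  where "convex_problem E X f xstar G \<longleftrightarrow>
    X \<subseteq> E \<and> X \<noteq> {} \<and> closed X \<and> convex X \<and> convex_on E f \<and>
    is_arg_min f (\<lambda>x. x \<in> X) xstar \<and>
    (\<forall>x\<in>X. \<forall>g\<in>subdifferential E f x. norm g \<le> G)"

end

theory Submission
  imports Defs
begin

text \<open>
  Write \<open>V t\<close> for the sum of \<open>G\<^sup>2\<close> and the squared norms of the first \<open>t\<close> subgradients, so that the
  stepsize at time \<open>t\<close> is \<open>h / sqrt (V t)\<close>. The regret of a projected subgradient method controls a
  weighted average of the suboptimality gaps. For nonincreasing stepsizes it also controls the
  gap at \<open>x N\<close>: the average over the last \<open>k\<close> iterates grows little when \<open>k\<close> decreases to \<open>1\<close>,
  because the regret may be measured against the iterate that is dropped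
  (\<open>last_term_le_weighted_average\<close>). The price is a sum of the terms \<open>\<parallel>g t\<parallel>\<^sup>2 / V t\<close> with weights of
  order \<open>1 / (N - t)\<close>. As \<open>V N\<close> exceeds \<open>V t\<close> by at most \<open>(N - t) * G\<^sup>2\<close>, this sum is no larger than
  for a constant stepsize, up to a logarithm (\<open>adagrad_variation_le\<close>). In the final step, from \<open>x N\<close>
  to \<open>x (N + 1)\<close>, the function increases by at most \<open>G\<close> times the length of the step. All together
  (\<open>adagrad_gap_le\<close>), up to constants,

  \<open>f (x (N + 1)) - f xstar \<le> sqrt (V N) * R\<^sup>2 / (h * N) + h * G\<^sup>2 / sqrt (V N) * (1 + ln N)\<close>.

  With \<open>h = R / N powr \<gamma>\<close> and \<open>sqrt (V N)\<close> of order \<open>G * N powr \<delta>\<close>, the two terms are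
  \<open>G * R * N powr (\<gamma> + \<delta> - 1)\<close> and \<open>G * R * N powr (- \<gamma> - \<delta>) * (1 + ln N)\<close>. The sign of
  \<open>\<gamma> + \<delta> - 1/2\<close> decides which of them dominates, and \<open>\<delta> = 0\<close> needs a separate argument, as the bound
  then has no logarithm (\<open>adagrad_rate\<close>).

  The instances required in the second part are found on a one-point set \<open>X\<close>, where every gap is zero.
\<close>

section \<open>Sums for the last-iterate estimate\<close>

text \<open>
  Index \<open>j\<close> counts steps back from the last iterate, so \<open>e\<close> are stepsizes and \<open>p\<close> suboptimality
  gaps in reverse order. Let \<open>S k\<close> be the average of the last \<open>k\<close> values \<open>e j * p j\<close>. Passing from
  \<open>S (k + 1)\<close> to \<open>S k\<close> drops the oldest value \<open>e k * p k\<close>, and the regret measured against that very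
  iterate bounds the cost: \<open>S k - S (k + 1)\<close> is at most the regret divided by \<open>k (k + 1)\<close>. Summing
  these differences telescopes from the average over all iterates down to the last one alone.
\<close>

lemma last_term_le_weighted_average:
  fixes e p b :: "nat \<Rightarrow> real"
  assumes mono: "\<And>j k. j \<le> k \<Longrightarrow> k \<le> n \<Longrightarrow> e j \<le> e k"
    and nonneg: "\<And>j. j \<le> n \<Longrightarrow> 0 \<le> p j"
    and regret: "\<And>k. k \<le> n \<Longrightarrow> (\<Sum>j\<le>k. e j * (p j - p k)) \<le> (\<Sum>j\<le>k. b j)"
  shows "e 0 * p 0 \<le> (\<Sum>j\<le>n. e j * p j) / real (n + 1)
           + (\<Sum>k=1..n. (\<Sum>j\<le>k. b j) / (real k * real (k + 1)))"
  using assms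
proof (induction n)
  case 0
  then show ?case by simp
next
  case (Suc n)
  let ?m = "real (Suc n)"
  let ?A = "\<Sum>j\<le>n. e j * p j" and ?B = "\<Sum>j\<le>Suc n. b j"
  let ?r = "e (Suc n) * p (Suc n)"
  have IH: "e 0 * p 0 \<le> ?A / real (n + 1)
      + (\<Sum>k=1..n. (\<Sum>j\<le>k. b j) / (real k * real (k + 1)))"
    by (rule Suc.IH) (use Suc.prems in auto)
  \<comment> \<open>Monotonicity of the steps turns the regret against the iterate \<open>p (n + 1)\<close> into a lower
    bound for its weighted value.\<close>
  have "?A - ?m * ?r = (\<Sum>j\<le>n. e j * p j - ?r)"
    by (simp add: sum_subtractf)
  also have "\<dots> \<le> (\<Sum>j\<le>n. e j * (p j - p (Suc n)))"
  proof (rule sum_mono)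
    fix j assume "j \<in> {..n}"
    then have "e j * p (Suc n) \<le> ?r"
      using Suc.prems(1)[of j "Suc n"] Suc.prems(2)[of "Suc n"] by (simp add: mult_right_mono)
    then show "e j * p j - ?r \<le> e j * (p j - p (Suc n))"
      by (simp add: algebra_simps)
  qed
  also have "\<dots> \<le> ?B"
    using Suc.prems(3)[of "Suc n"] by simp
  finally have "?A - ?m * ?r \<le> ?B" .
  then have "(?A - ?m * ?r) / (?m * (?m + 1)) \<le> ?B / (?m * (?m + 1))"
    by (rule divide_right_mono) simp
  moreover have "(?A - ?m * ?r) / (?m * (?m + 1)) = ?A / ?m - (?A + ?r) / (?m + 1)"
    by (simp add: field_simps)
  ultimately show ?case
    using IH by (simp add: add.commute)
qed

text \<open>
  Summation by parts with \<open>1 / (k (k + 1)) = 1 / k - 1 / (k + 1)\<close>: the factor \<open>1 / k\<close> cancels the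
  weight \<open>k\<close> in the increment \<open>k * u k\<close> of the inner sum. Bounding each weight \<open>j\<close> by \<open>k\<close> instead
  would cost an additional factor \<open>ln n\<close>.
\<close>

lemma sum_partial_moments_le:
  fixes u :: "nat \<Rightarrow> real"
  assumes "\<And>j. j \<le> n \<Longrightarrow> 0 \<le> u j"
  shows "(\<Sum>k=1..n. (\<Sum>j\<le>k. real j * u j) / (real k * real (k + 1))) \<le> (\<Sum>j\<le>n. u j)"
proof -
  have "(\<Sum>k=1..m. (\<Sum>j\<le>k. real j * u j) / (real k * real (k + 1)))
      = (\<Sum>j=1..m. u j) - (\<Sum>j\<le>m. real j * u j) / real (m + 1)" for m
  proof (induction m)
    case (Suc m)
    let ?M = "\<Sum>j\<le>m. real j * u j" and ?s = "real (Suc m)"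
    have "(?M + ?s * u (Suc m)) / (?s * (?s + 1))
        = ?M / ?s + u (Suc m) - (?M + ?s * u (Suc m)) / (?s + 1)"
      by (simp add: field_simps)
    with Suc show ?case
      by (simp add: add.commute)
  qed simp
  moreover have "0 \<le> (\<Sum>j\<le>n. real j * u j) / real (n + 1)"
    by (intro divide_nonneg_nonneg sum_nonneg mult_nonneg_nonneg) (use assms in auto)
  moreover have "(\<Sum>j=1..n. u j) \<le> (\<Sum>j\<le>n. u j)"
    by (rule sum_mono2) (use assms in auto)
  ultimately show ?thesis by simp
qed

text \<open>
  With \<open>V t\<close> the denominator, \<open>w t / V t = 1 - V (t - 1) / V t \<le> ln (V t) - ln (V (t - 1))\<close>, and the
  right-hand sides telescope.
\<close>

lemma sum_normalised_increments_le_ln: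
  fixes w :: "nat \<Rightarrow> real"
  assumes "0 < c" and "\<And>i. 0 \<le> w i"
  shows "(\<Sum>t=1..n. w t / (c + (\<Sum>i=1..t. w i))) \<le> ln ((c + (\<Sum>i=1..n. w i)) / c)"
proof (induction n)
  case 0
  then show ?case using assms by simp
next
  case (Suc n)
  let ?V = "\<lambda>t. c + (\<Sum>i=1..t. w i)"
  have pos: "0 < ?V t" for t
    by (rule add_pos_nonneg) (use assms in \<open>auto intro: sum_nonneg\<close>)
  have "ln (?V n / ?V (Suc n)) \<le> ?V n / ?V (Suc n) - 1"
    by (intro ln_le_minus_one divide_pos_pos pos)
  also have "\<dots> = - (w (Suc n) / ?V (Suc n))"
    using pos[of "Suc n"] by (simp add: field_simps)
  finally have "w (Suc n) / ?V (Suc n) \<le> ln (?V (Suc n)) - ln (?V n)"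
    using pos[of n] pos[of "Suc n"] by (simp add: ln_div)
  with Suc show ?case
    using pos[of n] pos[of "Suc n"] assms(1) by (simp add: ln_div)
qed

lemma harm_le_one_plus_ln:
  assumes "1 \<le> n"
  shows "(\<Sum>k=1..n. 1 / real k) \<le> 1 + ln (real n)"
  using euler_mascheroni_sequence_decreasing[of 1 n] assms
  by (simp add: harm_def inverse_eq_divide)

lemma sum_reverse:
  fixes u :: "nat \<Rightarrow> real"
  assumes "1 \<le> N"
  shows "(\<Sum>j\<le>N - 1. u (N - j)) = (\<Sum>t=1..N. u t)"
  by (rule sum.reindex_bij_witness[of _ "\<lambda>t. N - t" "\<lambda>j. N - j"]) (use assms in auto)

text \<open>
  The correction term of the last-iterate inequality for AdaGrad stepsizes. An early stepsize may
  exceed the last one by far, since \<open>V (N - j)\<close> may be much smaller than \<open>V N\<close>. But \<open>V\<close> grows by at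
  most \<open>c\<close> per step, so \<open>V N \<le> V (N - j) + j * c\<close>, and the ratio \<open>u j = w (N - j) / V (N - j)\<close> is
  at most \<open>c / V N * (1 + j * u j)\<close>. The constant part contributes a harmonic sum, and the part
  \<open>j * u j\<close>, after summation by parts, only the sum of all \<open>u j\<close>, which is at most \<open>ln (V N / c)\<close>.
\<close>

lemma adagrad_variation_le:
  fixes w :: "nat \<Rightarrow> real"
  assumes c: "0 < c" and w: "\<And>i. 0 \<le> w i" and wc: "\<And>i. i \<in> {1..N} \<Longrightarrow> w i \<le> c" and N: "1 \<le> N"
  defines "V \<equiv> \<lambda>t. c + (\<Sum>i=1..t. w i)"
  shows "(\<Sum>k=1..N - 1. (\<Sum>j\<le>k. w (N - j) / V (N - j)) / (real k * real (k + 1)))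
           \<le> c / V N * (1 + ln (real N) + ln (V N / c))"
proof -
  define u where "u j = w (N - j) / V (N - j)" for j
  have pos: "0 < V t" for t
    unfolding V_def by (rule add_pos_nonneg) (use c w in \<open>auto intro: sum_nonneg\<close>)
  have u: "0 \<le> u j" for j
    unfolding u_def using w pos[of "N - j"] by simp
  have grow: "V N \<le> V (N - j) + real j * c" if "j \<le> N - 1" for j
  proof -
    have "(\<Sum>i=1..N. w i) = (\<Sum>i=1..N - j. w i) + (\<Sum>i=N - j + 1..N. w i)"
      using sum.ub_add_nat[of 1 "N - j" w j] that N by simp
    moreover have "(\<Sum>i=N - j + 1..N. w i) \<le> (\<Sum>i=N - j + 1..N. c)"
      by (rule sum_mono) (use wc in auto)
    moreover have "(\<Sum>i=N - j + 1..N. c) = real j * c"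
      using that N by simp
    ultimately show ?thesis unfolding V_def by linarith
  qed
  have weight: "u j \<le> c / V N * (1 + real j * u j)" if j: "j \<le> N - 1" for j
  proof -
    have "u j * V N \<le> u j * (V (N - j) + real j * c)"
      using grow[OF j] u by (rule mult_left_mono)
    also have "\<dots> = w (N - j) + c * (real j * u j)"
      using pos[of "N - j"] by (simp add: u_def field_simps)
    also have "\<dots> \<le> c * (1 + real j * u j)"
      using wc[of "N - j"] j N by (simp add: algebra_simps)
    finally show ?thesis
      using pos[of N] by (simp add: field_simps)
  qed
  have "(\<Sum>k=1..N - 1. (\<Sum>j\<le>k. u j) / (real k * real (k + 1)))
      \<le> (\<Sum>k=1..N - 1. c / V N * (1 / real k + (\<Sum>j\<le>k. real j * u j) / (real k * real (k + 1))))"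
  proof (rule sum_mono)
    fix k assume k: "k \<in> {1..N - 1}"
    have "(\<Sum>j\<le>k. u j) \<le> (\<Sum>j\<le>k. c / V N * (1 + real j * u j))"
      by (rule sum_mono) (use weight k in auto)
    also have "\<dots> = c / V N * (real (k + 1) + (\<Sum>j\<le>k. real j * u j))"
      unfolding sum_distrib_left[symmetric] sum.distrib by simp
    finally have "(\<Sum>j\<le>k. u j) / (real k * real (k + 1))
        \<le> c / V N * (real (k + 1) + (\<Sum>j\<le>k. real j * u j)) / (real k * real (k + 1))"
      by (rule divide_right_mono) simp
    also have "\<dots> = c / V N * (1 / real k + (\<Sum>j\<le>k. real j * u j) / (real k * real (k + 1)))"
      unfolding times_divide_eq_right[symmetric] add_divide_distrib using k by simp
    finally show "(\<Sum>j\<le>k. u j) / (real k * real (k + 1))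
        \<le> c / V N * (1 / real k + (\<Sum>j\<le>k. real j * u j) / (real k * real (k + 1)))" .
  qed
  also have "\<dots> = c / V N * ((\<Sum>k=1..N - 1. 1 / real k)
      + (\<Sum>k=1..N - 1. (\<Sum>j\<le>k. real j * u j) / (real k * real (k + 1))))"
    unfolding sum_distrib_left[symmetric] sum.distrib ..
  also have "\<dots> \<le> c / V N * (1 + ln (real N) + ln (V N / c))"
  proof (intro mult_left_mono add_mono)
    have "(\<Sum>k=1..N - 1. 1 / real k) \<le> (\<Sum>k=1..N. 1 / real k)"
      by (rule sum_mono2) auto
    then show "(\<Sum>k=1..N - 1. 1 / real k) \<le> 1 + ln (real N)"
      using harm_le_one_plus_ln[OF N] by linarith
    have "(\<Sum>k=1..N - 1. (\<Sum>j\<le>k. real j * u j) / (real k * real (k + 1))) \<le> (\<Sum>j\<le>N - 1. u j)"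
      by (rule sum_partial_moments_le) (rule u)
    also have "\<dots> = (\<Sum>t=1..N. w t / V t)"
      unfolding u_def using sum_reverse[OF N, of "\<lambda>t. w t / V t"] .
    also have "\<dots> \<le> ln (V N / c)"
      unfolding V_def by (rule sum_normalised_increments_le_ln[OF c w])
    finally show "(\<Sum>k=1..N - 1. (\<Sum>j\<le>k. real j * u j) / (real k * real (k + 1))) \<le> ln (V N / c)" .
  qed (use c pos[of N] in simp)
  finally show ?thesis unfolding u_def .
qed


section \<open>Projections and subgradients in finite dimension\<close>

text \<open>
  The ambient space of finitely supported sequences is not complete, so closest points of closed sets
  have to be found inside the finite-dimensional \<open>Rd d\<close>.
\<close>

lemma complete_Rd: "complete (Rd d)"
proof (rule completeI)
  fix s :: "nat \<Rightarrow> fseq"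
  assume s: "\<forall>n. s n \<in> Rd d" and "Cauchy s"
  have coord_le: "\<bar>coord x i\<bar> \<le> norm x" if "x \<in> Rd d" "i < d" for x i
  proof -
    have "(coord x i)\<^sup>2 \<le> (\<Sum>i<d. (coord x i)\<^sup>2)"
      using that by (intro member_le_sum) auto
    then show ?thesis
      unfolding norm_Rd[OF that(1)] by (metis real_sqrt_abs real_sqrt_le_iff)
  qed
  have "\<exists>a. (\<lambda>n. coord (s n) i) \<longlonglongrightarrow> a" if "i < d" for i
  proof -
    have "Cauchy (\<lambda>n. coord (s n) i)"
    proof (rule metric_CauchyI)
      fix e :: real assume "0 < e"
      then obtain M where M: "\<forall>m\<ge>M. \<forall>n\<ge>M. dist (s m) (s n) < e"
        using \<open>Cauchy s\<close> unfolding Cauchy_def by blast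
      have "dist (coord (s m) i) (coord (s n) i) \<le> dist (s m) (s n)" for m n
        using coord_le[OF subspace_diff[OF subspace_Rd s[rule_format] s[rule_format]] that, of m n]
        by (simp add: dist_real_def dist_norm)
      with M show "\<exists>M. \<forall>m\<ge>M. \<forall>n\<ge>M. dist (coord (s m) i) (coord (s n) i) < e"
        by (meson le_less_trans)
    qed
    then show ?thesis
      by (simp add: Cauchy_convergent_iff convergent_def)
  qed
  then obtain a where a: "\<And>i. i < d \<Longrightarrow> (\<lambda>n. coord (s n) i) \<longlonglongrightarrow> a i"
    by metis
  obtain l where l: "l \<in> Rd d" "\<And>i. i < d \<Longrightarrow> coord l i = a i"
    using range_of_coords[of d a] by blast
  have "(\<lambda>n. sqrt (\<Sum>i<d. (coord (s n - l) i)\<^sup>2)) \<longlonglongrightarrow> sqrt (\<Sum>i<d. (a i - a i)\<^sup>2)"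
    using l(2) by (intro tendsto_real_sqrt tendsto_sum tendsto_power) (simp add: LIM_zero a)
  moreover have "norm (s n - l) = sqrt (\<Sum>i<d. (coord (s n - l) i)\<^sup>2)" for n
    by (rule norm_Rd) (simp add: subspace_diff subspace_Rd s l)
  ultimately have "(\<lambda>n. norm (s n - l)) \<longlonglongrightarrow> 0" by simp
  then have "s \<longlonglongrightarrow> l"
    by (simp add: LIM_zero_iff tendsto_norm_zero_iff)
  with l(1) show "\<exists>l\<in>Rd d. s \<longlonglongrightarrow> l" by blast
qed

text \<open>
  By the parallelogram law and convexity of \<open>X\<close>, every minimizing sequence of the distance to \<open>y\<close> is
  a Cauchy sequence.
\<close>

lemma closest_point_exists_complete:
  fixes X :: "'a::real_inner set"
  assumes "complete X" "convex X" "X \<noteq> {}"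
  shows "\<exists>p\<in>X. \<forall>z\<in>X. norm (p - y) \<le> norm (z - y)"
proof -
  define D where "D = Inf ((\<lambda>z. (norm (z - y))\<^sup>2) ` X)"
  have bdd: "bdd_below ((\<lambda>z. (norm (z - y))\<^sup>2) ` X)"
    by (rule bdd_belowI[of _ 0]) auto
  have D: "D \<le> (norm (z - y))\<^sup>2" if "z \<in> X" for z
    unfolding D_def using that by (intro cInf_lower bdd) auto
  have "\<exists>z\<in>X. (norm (z - y))\<^sup>2 < D + inverse (real (Suc n))" for n
    using cInf_less_iff[OF _ bdd, of "D + inverse (real (Suc n))"] \<open>X \<noteq> {}\<close>
    unfolding D_def[symmetric] by (simp del: of_nat_Suc)
  then obtain s where sX: "\<And>n. s n \<in> X"
    and s: "\<And>n. (norm (s n - y))\<^sup>2 < D + inverse (real (Suc n))"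
    by metis
  \<comment> \<open>The parallelogram law, with the midpoint of two members of \<open>X\<close> at distance at least
    \<open>sqrt D\<close> from \<open>y\<close>.\<close>
  have par: "(norm (a - b))\<^sup>2 \<le> 2 * ((norm (a - y))\<^sup>2 - D) + 2 * ((norm (b - y))\<^sup>2 - D)"
    if "a \<in> X" "b \<in> X" for a b
  proof -
    have "(1/2) *\<^sub>R a + (1/2) *\<^sub>R b \<in> X"
      using convexD[OF \<open>convex X\<close> that, of "1/2" "1/2"] by simp
    from D[OF this] have "4 * D \<le> 4 * (norm ((1/2) *\<^sub>R a + (1/2) *\<^sub>R b - y))\<^sup>2"
      by simp
    also have "\<dots> = 2 * (norm (a - y))\<^sup>2 + 2 * (norm (b - y))\<^sup>2 - (norm (a - b))\<^sup>2"
      by (simp add: power2_norm_eq_inner inner_simps inner_commute algebra_simps)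
    finally show ?thesis by simp
  qed
  have "Cauchy s"
  proof (rule metric_CauchyI)
    fix e :: real assume "0 < e"
    then obtain M where M: "inverse (real (Suc M)) < e\<^sup>2 / 4"
      using reals_Archimedean[of "e\<^sup>2 / 4"] by auto
    have le: "inverse (real (Suc n)) \<le> inverse (real (Suc M))" if "M \<le> n" for n
      using that by (intro le_imp_inverse_le) auto
    have near: "(norm (s n - y))\<^sup>2 - D < e\<^sup>2 / 4" if "M \<le> n" for n
      using less_le_trans[OF s add_left_mono[OF le[OF that]]] M by (simp add: algebra_simps)
    have "dist (s m) (s n) < e" if "M \<le> m" "M \<le> n" for m n
    proof -
      have "(norm (s m - s n))\<^sup>2 < e\<^sup>2"
        using par[OF sX sX, of m n] near[OF that(1)] near[OF that(2)] by (simp add: field_simps)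
      then show ?thesis
        using \<open>0 < e\<close> by (simp add: dist_norm power2_less_imp_less)
    qed
    then show "\<exists>M. \<forall>m\<ge>M. \<forall>n\<ge>M. dist (s m) (s n) < e" by blast
  qed
  with \<open>complete X\<close> sX obtain p where p: "p \<in> X" "s \<longlonglongrightarrow> p"
    unfolding complete_def by blast
  have "(norm (p - y))\<^sup>2 \<le> D"
  proof (rule LIMSEQ_le)
    show "(\<lambda>n. (norm (s n - y))\<^sup>2) \<longlonglongrightarrow> (norm (p - y))\<^sup>2"
      by (intro tendsto_intros p)
    show "(\<lambda>n. D + inverse (real (Suc n))) \<longlonglongrightarrow> D"
      using tendsto_add[OF tendsto_const LIMSEQ_inverse_real_of_nat, of D] by simp
    show "\<exists>N. \<forall>n\<ge>N. (norm (s n - y))\<^sup>2 \<le> D + inverse (real (Suc n))"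
      using s less_imp_le by blast
  qed
  then have "norm (p - y) \<le> norm (z - y)" if "z \<in> X" for z
    using D[OF that] by (meson norm_ge_zero order_trans power2_le_imp_le)
  with p(1) show ?thesis by blast
qed

lemma proj_Rd:
  assumes "X \<subseteq> Rd d" "closed X" "convex X" "X \<noteq> {}"
  shows proj_in: "proj X y \<in> X"
    and proj_nonexpansive: "z \<in> X \<Longrightarrow> norm (proj X y - z) \<le> norm (y - z)"
proof -
  have "complete X"
    using complete_closed_subset[OF assms(2,1) complete_Rd] .
  from closest_point_exists_complete[OF this assms(3,4)]
  obtain p where "p \<in> X" "\<forall>z\<in>X. norm (p - y) \<le> norm (z - y)" by blast
  then have "is_arg_min (\<lambda>x. norm (x - y)) (\<lambda>x. x \<in> X) p"
    by (auto simp: is_arg_min_linorder)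
  then have "is_arg_min (\<lambda>x. norm (x - y)) (\<lambda>x. x \<in> X) (proj X y)"
    unfolding proj_def arg_min_on_def arg_min_def by (rule someI)
  then have p: "proj X y \<in> X" "\<forall>z\<in>X. dist y (proj X y) \<le> dist y z"
    by (auto simp: is_arg_min_linorder dist_norm norm_minus_commute)
  then show "proj X y \<in> X" by simp
  assume z: "z \<in> X"
  let ?p = "proj X y"
  have "inner (y - ?p) (z - ?p) \<le> 0"
    by (rule any_closest_point_dot[OF assms(3,2) p(1) z p(2)])
  moreover have "(norm (y - z))\<^sup>2 = (norm (?p - z))\<^sup>2 + (norm (y - ?p))\<^sup>2 - 2 * inner (y - ?p) (z - ?p)"
    by (simp add: power2_norm_eq_inner inner_simps inner_commute algebra_simps)
  ultimately have "(norm (?p - z))\<^sup>2 \<le> (norm (y - z))\<^sup>2"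
    using zero_le_power2[of "norm (y - ?p)"] by linarith
  then show "norm (?p - z) \<le> norm (y - z)"
    by (rule power2_le_imp_le) simp
qed

text \<open>
  The one-dimensional step of the Hahn-Banach argument: a linear minorant of \<open>f\<close> on \<open>x + V\<close>, exact at
  \<open>x\<close>, extends to the direction \<open>e\<close>. The slope \<open>a\<close> has to lie above all difference quotients in
  direction \<open>- e\<close> (the set \<open>L\<close>) and below all those in direction \<open>e\<close>. Any quotient of the first kind
  is at most any of the second kind, because the two points involved have a convex combination in
  \<open>x + V\<close>.
\<close>

lemma supporting_slope_extend:
  fixes f :: "'a::real_inner \<Rightarrow> real"
  assumes f: "convex_on E f" and V: "subspace V"
    and inE: "\<And>v t. v \<in> V \<Longrightarrow> x + (v + t *\<^sub>R e) \<in> E"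
    and g: "\<And>v. v \<in> V \<Longrightarrow> f x + inner g v \<le> f (x + v)"
  shows "\<exists>a. \<forall>v\<in>V. \<forall>t. f x + inner g v + a * t \<le> f (x + (v + t *\<^sub>R e))"
proof -
  define L where "L = (\<lambda>(v, s). (f x + inner g v - f (x + (v + (-s) *\<^sub>R e))) / s) ` (V \<times> {0<..})"
  have key: "(f x + inner g v1 - f (x + (v1 + (-s) *\<^sub>R e))) / s
      \<le> (f (x + (v2 + t *\<^sub>R e)) - f x - inner g v2) / t"
    if "v1 \<in> V" "v2 \<in> V" "0 < s" "0 < t" for v1 v2 s t
  proof -
    define \<alpha> \<beta> where "\<alpha> = t / (s + t)" and "\<beta> = s / (s + t)"
    \<comment> \<open>The weights for which the two displacements along \<open>e\<close> cancel.\<close>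
    have ab: "0 \<le> \<alpha>" "0 \<le> \<beta>" "\<alpha> + \<beta> = 1" "\<alpha> * s = \<beta> * t"
      using that by (auto simp: \<alpha>_def \<beta>_def add_divide_distrib[symmetric])
    define F1 F2 where "F1 = f (x + (v1 + (-s) *\<^sub>R e))" and "F2 = f (x + (v2 + t *\<^sub>R e))"
    have "\<alpha> *\<^sub>R (x + (v1 + (-s) *\<^sub>R e)) + \<beta> *\<^sub>R (x + (v2 + t *\<^sub>R e))
        = (\<alpha> + \<beta>) *\<^sub>R x + (\<alpha> *\<^sub>R v1 + \<beta> *\<^sub>R v2) + (\<beta> * t - \<alpha> * s) *\<^sub>R e"
      by (simp add: algebra_simps)
    then have comb: "\<alpha> *\<^sub>R (x + (v1 + (-s) *\<^sub>R e)) + \<beta> *\<^sub>R (x + (v2 + t *\<^sub>R e))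
        = x + (\<alpha> *\<^sub>R v1 + \<beta> *\<^sub>R v2)"
      using ab by simp
    have "f x + inner g (\<alpha> *\<^sub>R v1 + \<beta> *\<^sub>R v2) \<le> f (x + (\<alpha> *\<^sub>R v1 + \<beta> *\<^sub>R v2))"
      by (rule g) (simp add: V subspace_add subspace_scale that)
    also have "\<dots> \<le> \<alpha> * F1 + \<beta> * F2"
      unfolding comb[symmetric] F1_def F2_def
      using f ab(1-3) inE[OF that(1), of "-s"] inE[OF that(2), of t] unfolding convex_on_def by blast
    finally have "f x + inner g (\<alpha> *\<^sub>R v1 + \<beta> *\<^sub>R v2) \<le> \<alpha> * F1 + \<beta> * F2" .
    moreover have "f x = (\<alpha> + \<beta>) * f x" using ab by simp
    ultimately have "\<alpha> * (f x + inner g v1 - F1) \<le> \<beta> * (F2 - f x - inner g v2)"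
      by (simp add: inner_simps algebra_simps)
    then have "t * (f x + inner g v1 - F1) \<le> s * (F2 - f x - inner g v2)"
      using that by (simp add: \<alpha>_def \<beta>_def divide_le_cancel)
    then show ?thesis
      unfolding F1_def[symmetric] F2_def[symmetric] using that by (simp add: field_simps)
  qed
  have 0: "0 \<in> V" using V by (rule subspace_0)
  have ne: "L \<noteq> {}" unfolding L_def using 0 by (force intro: exI[of _ 1])
  have ub: "l \<le> (f (x + (v + t *\<^sub>R e)) - f x - inner g v) / t" if "l \<in> L" "v \<in> V" "0 < t" for l v t
    using that(1) key[OF _ that(2) _ that(3)] by (auto simp: L_def)
  have bdd: "bdd_above L"
    using ub[OF _ 0, of _ 1] by (intro bdd_aboveI) auto
  have "f x + inner g v + Sup L * t \<le> f (x + (v + t *\<^sub>R e))" if v: "v \<in> V" for v t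
  proof (cases t "0 :: real" rule: linorder_cases)
    case less
    then have "(f x + inner g v - f (x + (v + (- (- t)) *\<^sub>R e))) / (- t) \<in> L"
      unfolding L_def using v by (force intro: image_eqI[of _ _ "(v, - t)"])
    from cSup_upper[OF this bdd] show ?thesis
      using less by (simp add: field_simps)
  next
    case equal
    then show ?thesis using g[OF v] by simp
  next
    case greater
    have "Sup L \<le> (f (x + (v + t *\<^sub>R e)) - f x - inner g v) / t"
      using ub[OF _ v greater] by (intro cSup_least ne)
    then show ?thesis using greater by (simp add: field_simps)
  qed
  then show ?thesis by blast
qed

text \<open>
  Supplies a subgradient at the last iterate, where the algorithm queries none, so that the bound on
  the norms of subgradients can be applied there. It is built one coordinate at a time.
\<close>

lemma subdifferential_nonempty:
  assumes f: "convex_on (Rd d) f" and x: "x \<in> Rd d"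
  shows "subdifferential (Rd d) f x \<noteq> {}"
proof -
  have "\<exists>g\<in>Rd m. \<forall>v\<in>Rd m. f x + inner g v \<le> f (x + v)" if "m \<le> d" for m
    using that
  proof (induction m)
    case 0
    have "v = 0" if "v \<in> Rd 0" for v
      using that by (intro fseq_eqI) (simp add: Rd_def)
    then show ?case
      using subspace_0[OF subspace_Rd[of 0]] by force
  next
    case (Suc m)
    then obtain g where g: "g \<in> Rd m" "\<And>v. v \<in> Rd m \<Longrightarrow> f x + inner g v \<le> f (x + v)"
      by auto
    obtain e where e: "e \<in> Rd (Suc m)" "\<forall>j<Suc m. coord e j = (if j = m then 1 else 0)"
      using range_of_coords[of "Suc m" "\<lambda>j. if j = m then 1 else 0"] by blast
    have inner_e: "inner e v = coord v m" for v
      using e(2) by (simp add: inner_Rd[OF e(1)])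
    have mono: "Rd k \<subseteq> Rd l" if "k \<le> l" for k l
      using that by (auto simp: Rd_def)
    have e_d: "e \<in> Rd d" and Rm: "Rd m \<subseteq> Rd d" and gS: "g \<in> Rd (Suc m)"
      using mono[of "Suc m" d] mono[of m d] mono[of m "Suc m"] Suc.prems e(1) g(1) by auto
    have "\<exists>a. \<forall>v\<in>Rd m. \<forall>t. f x + inner g v + a * t \<le> f (x + (v + t *\<^sub>R e))"
    proof (rule supporting_slope_extend[OF f subspace_Rd])
      show "x + (v + t *\<^sub>R e) \<in> Rd d" if "v \<in> Rd m" for v t
        using that e_d Rm x by (intro subspace_add subspace_scale subspace_Rd) auto
    qed (rule g(2))
    then obtain a where a: "\<And>v t. v \<in> Rd m \<Longrightarrow> f x + inner g v + a * t \<le> f (x + (v + t *\<^sub>R e))"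
      by blast
    have "f x + inner (g + a *\<^sub>R e) v \<le> f (x + v)" if v: "v \<in> Rd (Suc m)" for v
    proof -
      let ?t = "coord v m"
      have "coord (v - ?t *\<^sub>R e) i = 0" if "m \<le> i" for i
      proof (cases "i = m")
        case True
        then show ?thesis using e(2) by simp
      next
        case False
        then show ?thesis using v e(1) that by (simp add: Rd_def)
      qed
      then have "v - ?t *\<^sub>R e \<in> Rd m" unfolding Rd_def by blast
      from a[OF this, of ?t] have "f x + inner g (v - ?t *\<^sub>R e) + a * ?t \<le> f (x + v)"
        by simp
      moreover have "inner g e = 0"
        using g(1) inner_e[of g] by (simp add: inner_commute[of g e] Rd_def)
      ultimately show ?thesis
        by (simp add: inner_add_left inner_diff_right inner_e)
    qed
    moreover have "g + a *\<^sub>R e \<in> Rd (Suc m)"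
      using gS e(1) by (intro subspace_add subspace_scale subspace_Rd)
    ultimately show ?case by blast
  qed
  from this[of d] obtain g where g: "g \<in> Rd d" "\<And>v. v \<in> Rd d \<Longrightarrow> f x + inner g v \<le> f (x + v)"
    by auto
  have "f x + inner g (y - x) \<le> f y" if "y \<in> Rd d" for y
    using g(2)[of "y - x"] that x by (simp add: subspace_diff subspace_Rd)
  with g(1) show ?thesis by (auto simp: subdifferential_def)
qed


section \<open>The gap of the last AdaGrad iterate\<close>

text \<open>
  The standard telescoping estimate, over the window of steps from \<open>N - k\<close> to \<open>N\<close> and against any
  comparison point \<open>z\<close>. The choice \<open>z = x (N - k)\<close> makes the distance term vanish.
\<close>

lemma subgradient_regret:
  fixes x g :: "nat \<Rightarrow> 'a::real_inner" and f :: "'a \<Rightarrow> real"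
  assumes step: "\<And>t. t \<in> {1..N} \<Longrightarrow> norm (x (t + 1) - z) \<le> norm (x t - \<eta> t *\<^sub>R g t - z)"
    and sub: "\<And>t. t \<in> {1..N} \<Longrightarrow> f (x t) + inner (g t) (z - x t) \<le> f z"
    and \<eta>: "\<And>t. 0 \<le> \<eta> t" and "k < N"
  shows "(\<Sum>j\<le>k. \<eta> (N - j) * (f (x (N - j)) - f z))
    \<le> (norm (x (N - k) - z))\<^sup>2 / 2 + (\<Sum>j\<le>k. (\<eta> (N - j))\<^sup>2 * (norm (g (N - j)))\<^sup>2) / 2"
  using \<open>k < N\<close>
proof (induction k)
  have one: "\<eta> t * (f (x t) - f z) \<le> (norm (x t - z))\<^sup>2 / 2 - (norm (x (t + 1) - z))\<^sup>2 / 2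
      + (\<eta> t)\<^sup>2 * (norm (g t))\<^sup>2 / 2" if t: "t \<in> {1..N}" for t
  proof -
    have "(norm (x (t + 1) - z))\<^sup>2 \<le> (norm (x t - \<eta> t *\<^sub>R g t - z))\<^sup>2"
      using step[OF t] by (rule power_mono) simp
    also have "\<dots> = (norm (x t - z))\<^sup>2 + 2 * (\<eta> t * inner (g t) (z - x t)) + (\<eta> t)\<^sup>2 * (norm (g t))\<^sup>2"
      unfolding power2_norm_eq_inner
      by (simp add: inner_simps inner_commute algebra_simps power2_eq_square)
    finally have "- (\<eta> t * inner (g t) (z - x t)) \<le> (norm (x t - z))\<^sup>2 / 2 - (norm (x (t + 1) - z))\<^sup>2 / 2
      + (\<eta> t)\<^sup>2 * (norm (g t))\<^sup>2 / 2" by simp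
    moreover have "\<eta> t * (f (x t) - f z) \<le> \<eta> t * (- inner (g t) (z - x t))"
      using sub[OF t] \<eta> by (intro mult_left_mono) auto
    ultimately show ?thesis by simp
  qed
  {
    case 0
    have "N \<in> {1..N}" using 0 by simp
    note one[OF this]
    moreover have "0 \<le> (norm (x (N + 1) - z))\<^sup>2 / 2" by simp
    ultimately have "\<eta> N * (f (x N) - f z) \<le> (norm (x N - z))\<^sup>2 / 2 + (\<eta> N)\<^sup>2 * (norm (g N))\<^sup>2 / 2"
      by linarith
    then show ?case by simp
  next
    case (Suc k)
    have "N - Suc k \<in> {1..N}" "N - Suc k + 1 = N - k" using Suc.prems by auto
    with one[of "N - Suc k"] Suc show ?case by (simp add: add_divide_distrib)
  }
qed

lemma adagrad_iterate_in:
  assumes prob: "convex_problem (Rd d) X f xstar G" and run: "adagrad_run (Rd d) X f G h N x g"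
    and t: "t \<in> {1..N + 1}"
  shows "x t \<in> X"
proof (cases "t = 1")
  case True
  then show ?thesis using run by (simp add: adagrad_run_def)
next
  case False
  with t obtain s where "s \<in> {1..N}" "t = s + 1"
    by (cases t) auto
  then have "x t = proj X (x s - adagrad_step h G g s *\<^sub>R g s)"
    using run by (simp add: adagrad_run_def)
  then show ?thesis
    using prob proj_in[of X d] by (simp add: convex_problem_def)
qed

lemma adagrad_subgradient_norm_le:
  assumes prob: "convex_problem (Rd d) X f xstar G" and run: "adagrad_run (Rd d) X f G h N x g"
    and t: "t \<in> {1..N}"
  shows "norm (g t) \<le> G"
proof -
  have "x t \<in> X"
    using adagrad_iterate_in[OF prob run, of t] t by auto
  moreover have "g t \<in> subdifferential (Rd d) f (x t)"
    using run t by (simp add: adagrad_run_def)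
  ultimately show ?thesis
    using prob by (auto simp: convex_problem_def)
qed

text \<open>
  The regret against \<open>xstar\<close> over the whole run bounds the weighted average of the gaps, and the
  regret against each iterate over the steps after it bounds the loss incurred in passing from that
  average to \<open>x N\<close>. The regret estimate cannot be applied at \<open>x (N + 1)\<close>, at which no step is taken;
  its value is instead compared with \<open>f (x N)\<close> by the Lipschitz property.
\<close>

lemma adagrad_gap_le:
  fixes x g :: "nat \<Rightarrow> fseq"
  assumes prob: "convex_problem (Rd d) X f xstar G" and run: "adagrad_run (Rd d) X f G h N x g"
    and G: "0 < G" and h: "0 < h" and N: "1 \<le> N" and R: "norm (x 1 - xstar) \<le> R"
  defines "V \<equiv> \<lambda>t. G\<^sup>2 + (\<Sum>i=1..t. (norm (g i))\<^sup>2)"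
  shows last_step_increase_le: "f (x (N + 1)) - f (x N) \<le> h * G\<^sup>2 / sqrt (V N)"
    and penultimate_gap_le: "f (x N) - f xstar
      \<le> sqrt (V N) * R\<^sup>2 / (2 * h * real N) + 2 * h * G\<^sup>2 / sqrt (V N) * (1 + ln (real N))"
proof -
  have XR: "X \<subseteq> Rd d" and X: "closed X" "convex X" "X \<noteq> {}" and f: "convex_on (Rd d) f"
    and star: "xstar \<in> X" and opt: "\<And>z. z \<in> X \<Longrightarrow> f xstar \<le> f z"
    and gG: "\<And>y v. y \<in> X \<Longrightarrow> v \<in> subdifferential (Rd d) f y \<Longrightarrow> norm v \<le> G"
    using prob by (auto simp: convex_problem_def is_arg_min_linorder)
  define \<eta> where "\<eta> = adagrad_step h G g"
  have \<eta>_eq: "\<eta> t = h / sqrt (V t)" for t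
    by (simp add: \<eta>_def adagrad_step_def V_def)
  have Vpos: "0 < V t" for t
    unfolding V_def using G by (intro add_pos_nonneg sum_nonneg) auto
  have Vmono: "V s \<le> V t" if "s \<le> t" for s t
    unfolding V_def using that by (intro add_left_mono sum_mono2) auto
  have \<eta>pos: "0 < \<eta> t" for t
    using h Vpos by (simp add: \<eta>_eq)
  have gs: "\<And>t. t \<in> {1..N} \<Longrightarrow> g t \<in> subdifferential (Rd d) f (x t)"
    and xs: "\<And>t. t \<in> {1..N} \<Longrightarrow> x (t + 1) = proj X (x t - \<eta> t *\<^sub>R g t)"
    using run by (auto simp: adagrad_run_def \<eta>_def)
  have xX: "x t \<in> X" if "t \<in> {1..N + 1}" for t
    by (rule adagrad_iterate_in[OF prob run that])
  have step: "norm (x (t + 1) - z) \<le> norm (x t - \<eta> t *\<^sub>R g t - z)" if "t \<in> {1..N}" "z \<in> X" for t z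
    unfolding xs[OF that(1)] by (rule proj_nonexpansive[OF XR X that(2)])
  have sub: "f (x t) + inner (g t) (z - x t) \<le> f z" if "t \<in> {1..N}" "z \<in> X" for t z
    using gs[OF that(1)] that(2) XR by (auto simp: subdifferential_def)
  have gle: "norm (g t) \<le> G" if "t \<in> {1..N}" for t
    by (rule adagrad_subgradient_norm_le[OF prob run that])
  have wle: "(norm (g t))\<^sup>2 \<le> G\<^sup>2" if "t \<in> {1..N}" for t
    using gle[OF that] by (simp add: power_mono)

  show "f (x (N + 1)) - f (x N) \<le> h * G\<^sup>2 / sqrt (V N)"
  proof -
    have NX: "x (N + 1) \<in> X" "x N \<in> X" using N by (auto intro: xX)
    then obtain v where v: "v \<in> subdifferential (Rd d) f (x (N + 1))"
      using subdifferential_nonempty[OF f] XR by blast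
    then have "f (x (N + 1)) - f (x N) \<le> inner v (x (N + 1) - x N)"
      using NX XR by (force simp: subdifferential_def inner_diff_right)
    also have "\<dots> \<le> norm v * norm (x (N + 1) - x N)"
      by (rule norm_cauchy_schwarz)
    also have "\<dots> \<le> G * (\<eta> N * G)"
    proof (intro mult_mono)
      have "norm (x (N + 1) - x N) \<le> \<eta> N * norm (g N)"
        using step[of N "x N"] NX N \<eta>pos[of N] by simp
      also have "\<dots> \<le> \<eta> N * G"
        using gle[of N] N \<eta>pos[of N] by simp
      finally show "norm (x (N + 1) - x N) \<le> \<eta> N * G" .
    qed (use G gG[OF NX(1) v] in auto)
    finally show ?thesis by (simp add: \<eta>_eq power2_eq_square mult_ac)
  qed

  define b where "b j = (\<eta> (N - j))\<^sup>2 * (norm (g (N - j)))\<^sup>2 / 2" for j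
  define L where "L = ln (V N / G\<^sup>2)"
  have b_eq: "b j = h\<^sup>2 / 2 * ((norm (g (N - j)))\<^sup>2 / V (N - j))" for j
    using Vpos[of "N - j"] by (simp add: b_def \<eta>_eq power_divide)
  have regret: "(\<Sum>j\<le>k. \<eta> (N - j) * (f (x (N - j)) - f z))
      \<le> (norm (x (N - k) - z))\<^sup>2 / 2 + (\<Sum>j\<le>k. b j)" if "k < N" "z \<in> X" for k z
    using subgradient_regret[where f = f and x = x and g = g and \<eta> = \<eta>,
        OF step[OF _ that(2)] sub[OF _ that(2)] less_imp_le[OF \<eta>pos] that(1)]
    by (simp add: b_def sum_divide_distrib)
  have bsum: "(\<Sum>j\<le>N - 1. b j) \<le> h\<^sup>2 / 2 * L"
  proof -
    have "(\<Sum>j\<le>N - 1. b j) = h\<^sup>2 / 2 * (\<Sum>t=1..N. (norm (g t))\<^sup>2 / V t)"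
      unfolding b_eq sum_distrib_left[symmetric] using sum_reverse[OF N, of "\<lambda>t. (norm (g t))\<^sup>2 / V t"] by simp
    also have "\<dots> \<le> h\<^sup>2 / 2 * L"
      unfolding L_def V_def using G by (intro mult_left_mono sum_normalised_increments_le_ln) auto
    finally show ?thesis .
  qed
  have avg: "(\<Sum>j\<le>N - 1. \<eta> (N - j) * (f (x (N - j)) - f xstar)) \<le> R\<^sup>2 / 2 + h\<^sup>2 / 2 * L"
  proof -
    have "(norm (x 1 - xstar))\<^sup>2 \<le> R\<^sup>2" using R by (simp add: power_mono)
    with regret[of "N - 1" xstar] bsum N star show ?thesis by simp
  qed
  have var: "(\<Sum>k=1..N - 1. (\<Sum>j\<le>k. b j) / (real k * real (k + 1)))
      \<le> h\<^sup>2 / 2 * (G\<^sup>2 / V N * (1 + ln (real N) + L))"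
  proof -
    have "(\<Sum>k=1..N - 1. (\<Sum>j\<le>k. b j) / (real k * real (k + 1)))
        = h\<^sup>2 / 2 * (\<Sum>k=1..N - 1. (\<Sum>j\<le>k. (norm (g (N - j)))\<^sup>2 / V (N - j)) / (real k * real (k + 1)))"
      unfolding b_eq by (simp only: sum_distrib_left times_divide_eq_right)
    also have "\<dots> \<le> h\<^sup>2 / 2 * (G\<^sup>2 / V N * (1 + ln (real N) + L))"
      unfolding L_def V_def using G wle N by (intro mult_left_mono adagrad_variation_le) auto
    finally show ?thesis .
  qed
  have Vle: "V N \<le> G\<^sup>2 * (real N + 1)"
  proof -
    have "(\<Sum>i=1..N. (norm (g i))\<^sup>2) \<le> (\<Sum>i=1..N. G\<^sup>2)"
      by (rule sum_mono) (rule wle)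
    then show ?thesis by (simp add: V_def algebra_simps)
  qed
  have L: "0 \<le> L" "L \<le> 1 + ln (real N)"
  proof -
    have "V 0 \<le> V N" by (rule Vmono) simp
    then show "0 \<le> L" using G by (simp add: L_def V_def)
    have "V N / G\<^sup>2 \<le> real N + 1" using Vle G by (simp add: field_simps)
    also have "\<dots> \<le> 2 * real N" using N by simp
    finally have "L \<le> ln (2 * real N)"
      unfolding L_def using Vpos[of N] G N by (intro ln_mono) auto
    also have "\<dots> \<le> 1 + ln (real N)"
      using N ln_le_minus_one[of 2] by (simp add: ln_mult)
    finally show "L \<le> 1 + ln (real N)" .
  qed
  have "\<eta> N * (f (x N) - f xstar)
      \<le> (\<Sum>j\<le>N - 1. \<eta> (N - j) * (f (x (N - j)) - f xstar)) / real (N - 1 + 1)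
        + (\<Sum>k=1..N - 1. (\<Sum>j\<le>k. b j) / (real k * real (k + 1)))"
  proof (rule last_term_le_weighted_average[where e = "\<lambda>j. \<eta> (N - j)" and p = "\<lambda>j. f (x (N - j)) - f xstar", simplified diff_zero])
    show "\<eta> (N - j) \<le> \<eta> (N - k)" if "j \<le> k" for j k
      unfolding \<eta>_eq using that h Vpos[of "N - j"] Vpos[of "N - k"] Vmono[of "N - k" "N - j"]
      by (intro divide_left_mono) auto
    show "0 \<le> f (x (N - j)) - f xstar" if "j \<le> N - 1" for j
    proof -
      have "N - j \<in> {1..N + 1}" using that N by auto
      from opt[OF xX[OF this]] show ?thesis by simp
    qed
    show "(\<Sum>j\<le>k. \<eta> (N - j) * (f (x (N - j)) - f xstar - (f (x (N - k)) - f xstar))) \<le> (\<Sum>j\<le>k. b j)"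
      if "k \<le> N - 1" for k
    proof -
      have "N - k \<in> {1..N + 1}" "k < N" using that N by auto
      from regret[OF this(2) xX[OF this(1)]] show ?thesis by simp
    qed
  qed
  also have "\<dots> \<le> (R\<^sup>2 / 2 + h\<^sup>2 / 2 * L) / real N + h\<^sup>2 / 2 * (G\<^sup>2 / V N * (1 + ln (real N) + L))"
    using avg var N by (intro add_mono) (auto simp: divide_right_mono)
  also have "\<dots> \<le> R\<^sup>2 / 2 / real N + h\<^sup>2 / 2 * (G\<^sup>2 / V N * (4 * (1 + ln (real N))))"
  proof -
    \<comment> \<open>The logarithm of the averaged bound is absorbed because \<open>1 / N \<le> 2 G\<^sup>2 / V N\<close>.\<close>
    have "V N \<le> 2 * G\<^sup>2 * real N"
    proof -
      have "G\<^sup>2 * 1 \<le> G\<^sup>2 * real N" using N by (intro mult_left_mono) auto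
      then show ?thesis using Vle unfolding distrib_left by linarith
    qed
    then have "1 / real N \<le> 2 * G\<^sup>2 / V N"
      using Vpos[of N] N by (simp add: divide_le_eq le_divide_eq)
    from mult_left_mono[OF this L(1)] have "L / real N \<le> L * (2 * (G\<^sup>2 / V N))"
      by simp
    also have "\<dots> = G\<^sup>2 / V N * (2 * L)" by simp
    finally have "L / real N + G\<^sup>2 / V N * (1 + ln (real N) + L)
        \<le> G\<^sup>2 / V N * (2 * L + (1 + ln (real N) + L))"
      by (simp only: distrib_left[of _ "2 * L"] add_right_mono)
    also have "\<dots> \<le> G\<^sup>2 / V N * (4 * (1 + ln (real N)))"
      using L(2) Vpos[of N] by (intro mult_left_mono) auto
    finally have "h\<^sup>2 / 2 * (L / real N + G\<^sup>2 / V N * (1 + ln (real N) + L))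
        \<le> h\<^sup>2 / 2 * (G\<^sup>2 / V N * (4 * (1 + ln (real N))))"
      by (intro mult_left_mono) auto
    then have "R\<^sup>2 / 2 / real N + (h\<^sup>2 / 2 * (L / real N) + h\<^sup>2 / 2 * (G\<^sup>2 / V N * (1 + ln (real N) + L)))
        \<le> R\<^sup>2 / 2 / real N + h\<^sup>2 / 2 * (G\<^sup>2 / V N * (4 * (1 + ln (real N))))"
      unfolding distrib_left[of _ "L / real N"] by (rule add_left_mono)
    then show ?thesis by (simp add: add_divide_distrib)
  qed
  finally have "f (x N) - f xstar
      \<le> (R\<^sup>2 / 2 / real N + h\<^sup>2 / 2 * (G\<^sup>2 / V N * (4 * (1 + ln (real N))))) / \<eta> N"
    using \<eta>pos[of N] by (simp add: pos_le_divide_eq mult.commute)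
  also have "\<dots> = sqrt (V N) * R\<^sup>2 / (2 * h * real N) + 2 * h * G\<^sup>2 / sqrt (V N) * (1 + ln (real N))"
  proof -
    define s where "s = sqrt (V N)"
    have "V N = s * s" "s > 0" using Vpos[of N] by (auto simp: s_def)
    then show ?thesis unfolding \<eta>_eq s_def[symmetric] using h N by (simp add: field_simps power2_eq_square)
  qed
  finally show "f (x N) - f xstar
      \<le> sqrt (V N) * R\<^sup>2 / (2 * h * real N) + 2 * h * G\<^sup>2 / sqrt (V N) * (1 + ln (real N))" .
qed

text \<open>
  A zero subgradient certifies a global minimum and leaves the iterate in place.
\<close>

lemma penultimate_optimal_of_zero_subgradients:
  fixes x g :: "nat \<Rightarrow> fseq"
  assumes prob: "convex_problem (Rd d) X f xstar G" and run: "adagrad_run (Rd d) X f G h N x g"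
    and N: "2 \<le> N" and zero: "g (N - 1) = 0"
  shows "f (x N) \<le> f xstar"
proof -
  have XR: "X \<subseteq> Rd d" and X: "closed X" "convex X" "X \<noteq> {}" and star: "xstar \<in> X"
    using prob by (auto simp: convex_problem_def is_arg_min_linorder)
  have "N - 1 \<in> {1..N}" using N by auto
  then have gN: "g (N - 1) \<in> subdifferential (Rd d) f (x (N - 1))"
    and xN: "x N = proj X (x (N - 1))"
    using run zero N unfolding adagrad_run_def by force+
  have min: "f (x (N - 1)) \<le> f y" if "y \<in> Rd d" for y
    using gN zero that by (force simp: subdifferential_def)
  have "x (N - 1) \<in> X"
    by (rule adagrad_iterate_in[OF prob run]) (use N in auto)
  then have "norm (x N - x (N - 1)) \<le> 0"
    using proj_nonexpansive[OF XR X, of "x (N - 1)" "x (N - 1)"] xN by simp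
  then show ?thesis
    using min star XR by auto
qed

text \<open>
  Only the energy of the first \<open>N - 1\<close> subgradients is prescribed, but the last one changes the sum
  under the root of the final stepsize by a factor of at most two, as it adds at most \<open>G\<^sup>2\<close> to a sum
  that is at least \<open>G\<^sup>2\<close>. Hence the root is of the order \<open>G * N powr \<delta>\<close>, and the two bounds of \<open>adagrad_gap_le\<close> become powers of \<open>N\<close>.
\<close>

lemma adagrad_last_iterate:
  fixes x g :: "nat \<Rightarrow> fseq"
  assumes prob: "convex_problem (Rd d) X f xstar G"
    and run: "adagrad_run (Rd d) X f G (R / real N powr \<gamma>) N x g"
    and G: "0 < G" and R: "0 < R" and N: "1 \<le> N" and start: "norm (x 1 - xstar) \<le> R"
    and energy: "G\<^sup>2 + (\<Sum>i=1..N - 1. (norm (g i))\<^sup>2) = G\<^sup>2 * real N powr (2 * \<delta>)"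
  shows adagrad_last_step_increase: "f (x (N + 1)) - f (x N) \<le> G * R * real N powr (- \<gamma> - \<delta>)"
    and adagrad_last_iterate_gap: "f (x (N + 1)) - f xstar
      \<le> G * R * real N powr (\<gamma> + \<delta> - 1) + 3 * (G * R * real N powr (- \<gamma> - \<delta>) * (1 + ln (real N)))"
proof -
  define h where "h = R / real N powr \<gamma>"
  define s where "s = sqrt (G\<^sup>2 + (\<Sum>i=1..N. (norm (g i))\<^sup>2))"
  define \<rho> where "\<rho> = G * R * real N powr (- \<gamma> - \<delta>)"
  have n: "0 < real N" using N by simp
  have h: "0 < h" using R n by (simp add: h_def)
  have root: "sqrt (G\<^sup>2 * real N powr (2 * \<delta>)) = G * real N powr \<delta>"
    using G by (simp add: real_sqrt_mult powr_half_sqrt_powr[symmetric] powr_powr)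
  have split: "(\<Sum>i=1..N. (norm (g i))\<^sup>2) = (\<Sum>i=1..N - 1. (norm (g i))\<^sup>2) + (norm (g N))\<^sup>2"
    using N by (cases N) auto
  have s_lower: "G * real N powr \<delta> \<le> s"
    unfolding root[symmetric] s_def energy[symmetric] split by (intro real_sqrt_le_mono) simp
  have spos: "0 < G * real N powr \<delta>" using G n by simp
  have s_upper: "s \<le> 2 * (G * real N powr \<delta>)"
  proof -
    have "norm (g N) \<le> G"
      using adagrad_subgradient_norm_le[OF prob run, of N] N by simp
    then have "(norm (g N))\<^sup>2 \<le> G\<^sup>2" by (simp add: power_mono)
    also have "G\<^sup>2 \<le> G\<^sup>2 * real N powr (2 * \<delta>)"
      unfolding energy[symmetric] by (simp add: sum_nonneg)
    finally have "(norm (g N))\<^sup>2 \<le> G\<^sup>2 * real N powr (2 * \<delta>)" .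
    moreover have "0 \<le> G\<^sup>2 * real N powr (2 * \<delta>)" by simp
    ultimately have "s \<le> sqrt (4 * (G\<^sup>2 * real N powr (2 * \<delta>)))"
      unfolding s_def split using energy by (intro real_sqrt_le_mono) linarith
    then show ?thesis unfolding real_sqrt_mult[of 4] root by simp
  qed
  have step: "h * G\<^sup>2 / s \<le> \<rho>"
  proof -
    have "h * G\<^sup>2 / s \<le> h * G\<^sup>2 / (G * real N powr \<delta>)"
      using s_lower spos h by (intro divide_left_mono) auto
    also have "\<dots> = \<rho>"
      using G n by (simp add: \<rho>_def h_def power2_eq_square powr_diff powr_minus divide_inverse)
    finally show ?thesis .
  qed
  have dist: "s * R\<^sup>2 / (2 * h * real N) \<le> G * R * real N powr (\<gamma> + \<delta> - 1)"
  proof -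
    have "s * R\<^sup>2 / (2 * h * real N) \<le> 2 * (G * real N powr \<delta>) * R\<^sup>2 / (2 * h * real N)"
      using s_upper h n by (intro divide_right_mono mult_right_mono) auto
    also have "\<dots> = G * R * real N powr (\<gamma> + \<delta> - 1)"
      using R n by (simp add: h_def power2_eq_square powr_diff powr_add)
    finally show ?thesis .
  qed
  note gap = adagrad_gap_le[OF prob run[folded h_def] G h N start, folded s_def]
  show incr: "f (x (N + 1)) - f (x N) \<le> G * R * real N powr (- \<gamma> - \<delta>)"
    using gap(1) step unfolding \<rho>_def by linarith
  have ln: "0 \<le> ln (real N)" using N by simp
  have "2 * (h * G\<^sup>2 / s) * (1 + ln (real N)) \<le> 2 * \<rho> * (1 + ln (real N))"
    using step ln by (intro mult_right_mono) auto
  moreover have "2 * h * G\<^sup>2 / s * (1 + ln (real N)) = 2 * (h * G\<^sup>2 / s) * (1 + ln (real N))"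
    by simp
  ultimately have pen: "f (x N) - f xstar
      \<le> G * R * real N powr (\<gamma> + \<delta> - 1) + 2 * \<rho> * (1 + ln (real N))"
    using gap(2) dist by linarith
  have "0 \<le> \<rho>" using G R by (simp add: \<rho>_def)
  then have "\<rho> \<le> \<rho> * (1 + ln (real N))" using ln by (simp add: distrib_left)
  then show "f (x (N + 1)) - f xstar
      \<le> G * R * real N powr (\<gamma> + \<delta> - 1) + 3 * (G * R * real N powr (- \<gamma> - \<delta>) * (1 + ln (real N)))"
    using pen incr unfolding \<rho>_def by linarith
qed

text \<open>
  The two powers in \<open>adagrad_last_iterate_gap\<close> balance at \<open>\<gamma> + \<delta> = 1/2\<close>. Above that value the first
  one dominates by a power \<open>N powr \<epsilon>\<close>, which absorbs the logarithm. Otherwise the second one dominates,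
  and \<open>ln N\<close> is \<open>ln (N powr (2 * \<delta>))\<close> up to the factor \<open>1 / (2 * \<delta>)\<close>. This fails for \<open>\<delta> = 0\<close>, where
  no logarithm is allowed; but then the first \<open>N - 1\<close> subgradients vanish, \<open>x N\<close> is optimal, and only
  the last step contributes.
\<close>

theorem adagrad_rate:
  assumes \<gamma>: "\<gamma> \<in> {0<..1/2::real}" and \<delta>: "\<delta> \<in> {0..1/2::real}"
  shows "\<exists>C>0.
        \<forall>(G::real) (R::real) (d::nat) X f xstar (N::nat) x g.
          G > 0 \<and> R > 0 \<and> d \<ge> 1 \<and> convex_problem (Rd d) X f xstar G \<and>
          N \<ge> 1 \<and> norm (x 1 - xstar) \<le> R \<and>
          adagrad_run (Rd d) X f G (R / real N powr \<gamma>) N x g \<and>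
          G\<^sup>2 + (\<Sum>i=1..N-1. (norm (g i))\<^sup>2) = G\<^sup>2 * real N powr (2 * \<delta>)
          \<longrightarrow>
          f (x (N + 1)) - f xstar \<le>
            (if \<gamma> + \<delta> \<le> 1/2
             then C * G * R * real N powr (- \<gamma> - \<delta>) * (1 + ln (real N powr (2 * \<delta>)))
             else C * G * R * real N powr (\<gamma> + \<delta> - 1))"
    (is "\<exists>C>0. \<forall>G R d X f xstar N x g. ?A G R d X f xstar N x g \<longrightarrow> _ \<le> ?B C G R N")
proof -
  have bound: "f (x (N + 1)) - f xstar
      \<le> G * R * (real N powr (\<gamma> + \<delta> - 1) + 3 * (real N powr (- \<gamma> - \<delta>) * (1 + ln (real N))))"
    if "?A G R d X f xstar N x g" for G R d X f xstar N x g
    using adagrad_last_iterate_gap[of d X f xstar G R N \<gamma> x g \<delta>] that by (simp add: distrib_left mult_ac)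
  consider (long) "1/2 < \<gamma> + \<delta>" | (short) "\<gamma> + \<delta> \<le> 1/2" "0 < \<delta>" | (zero) "\<delta> = 0"
    using \<delta> by fastforce
  then show ?thesis
  proof cases
    case long
    define \<epsilon> where "\<epsilon> = 2 * (\<gamma> + \<delta>) - 1"
    have \<epsilon>: "0 < \<epsilon>" using long by (simp add: \<epsilon>_def)
    have num: "real N powr (\<gamma> + \<delta> - 1) + 3 * (real N powr (- \<gamma> - \<delta>) * (1 + ln (real N)))
        \<le> (4 + 3 / \<epsilon>) * real N powr (\<gamma> + \<delta> - 1)" if N: "N \<ge> 1" for N :: nat
    proof -
      have "1 + ln (real N) \<le> real N powr \<epsilon> + real N powr \<epsilon> / \<epsilon>"
        using ln_powr_bound[of "real N" \<epsilon>] N \<epsilon> by (intro add_mono ge_one_powr_ge_zero) auto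
      then have "real N powr (- \<gamma> - \<delta>) * (1 + ln (real N))
          \<le> real N powr (- \<gamma> - \<delta>) * (real N powr \<epsilon> + real N powr \<epsilon> / \<epsilon>)"
        by (intro mult_left_mono) auto
      also have "\<dots> = (1 + 1 / \<epsilon>) * real N powr (\<gamma> + \<delta> - 1)"
      proof -
        have "real N powr (\<gamma> + \<delta> - 1) = real N powr (- \<gamma> - \<delta>) * real N powr \<epsilon>"
          unfolding powr_add[symmetric] by (simp add: \<epsilon>_def algebra_simps)
        then show ?thesis by (simp add: algebra_simps)
      qed
      finally show ?thesis by (simp add: algebra_simps)
    qed
    show ?thesis
    proof (intro exI[of _ "4 + 3 / \<epsilon>"] conjI allI impI)
      show "0 < 4 + 3 / \<epsilon>" using \<epsilon> by (simp add: add_pos_pos)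
      fix G R d X f xstar N x g assume A: "?A G R d X f xstar N x g"
      have "f (x (N + 1)) - f xstar \<le> G * R * ((4 + 3 / \<epsilon>) * real N powr (\<gamma> + \<delta> - 1))"
        by (rule order_trans[OF bound[OF A] mult_left_mono[OF num]]) (use A in auto)
      then show "f (x (N + 1)) - f xstar \<le> ?B (4 + 3 / \<epsilon>) G R N"
        using long by (simp add: mult_ac)
    qed
  next
    case short
    have num: "real N powr (\<gamma> + \<delta> - 1) + 3 * (real N powr (- \<gamma> - \<delta>) * (1 + ln (real N)))
        \<le> (1 + 3 / (2 * \<delta>)) * (real N powr (- \<gamma> - \<delta>) * (1 + ln (real N powr (2 * \<delta>))))"
      if N: "N \<ge> 1" for N :: nat
    proof -
      let ?p = "real N powr (- \<gamma> - \<delta>)"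
      have l: "0 \<le> ln (real N)" and lnp: "ln (real N powr (2 * \<delta>)) = 2 * \<delta> * ln (real N)"
        using N by (simp_all add: ln_powr)
      have "real N powr (\<gamma> + \<delta> - 1) \<le> ?p"
        using short N by (intro powr_mono) auto
      also have "\<dots> \<le> ?p * (1 + ln (real N powr (2 * \<delta>)))"
        unfolding lnp using l short by (simp add: distrib_left)
      finally have 1: "real N powr (\<gamma> + \<delta> - 1) \<le> ?p * (1 + ln (real N powr (2 * \<delta>)))" .
      have "1 + ln (real N) \<le> 1 / (2 * \<delta>) * (1 + ln (real N powr (2 * \<delta>)))"
        unfolding lnp using \<delta> short by (simp add: field_simps)
      then have "?p * (1 + ln (real N)) \<le> ?p * (1 / (2 * \<delta>) * (1 + ln (real N powr (2 * \<delta>))))"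
        by (rule mult_left_mono) simp
      also have "\<dots> = 1 / (2 * \<delta>) * (?p * (1 + ln (real N powr (2 * \<delta>))))"
        by (rule mult.left_commute)
      finally show ?thesis
        using 1 unfolding distrib_right[of 1] by simp
    qed
    show ?thesis
    proof (intro exI[of _ "1 + 3 / (2 * \<delta>)"] conjI allI impI)
      show "0 < 1 + 3 / (2 * \<delta>)" using short by (simp add: add_pos_pos)
      fix G R d X f xstar N x g assume A: "?A G R d X f xstar N x g"
      have "f (x (N + 1)) - f xstar
          \<le> G * R * ((1 + 3 / (2 * \<delta>)) * (real N powr (- \<gamma> - \<delta>) * (1 + ln (real N powr (2 * \<delta>)))))"
        by (rule order_trans[OF bound[OF A] mult_left_mono[OF num]]) (use A in auto)
      then show "f (x (N + 1)) - f xstar \<le> ?B (1 + 3 / (2 * \<delta>)) G R N"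
        using short by (simp add: mult_ac)
    qed
  next
    case zero
    show ?thesis
    proof (intro exI[of _ 4] conjI allI impI)
      fix G R d X f xstar N x g assume A: "?A G R d X f xstar N x g"
      then have GR: "0 \<le> G * R" by simp
      have "f (x (N + 1)) - f xstar \<le> 4 * (G * R * real N powr (- \<gamma>))"
      proof (cases "N = 1")
        case True
        then show ?thesis using bound[OF A] by simp
      next
        case False
        then have N: "2 \<le> N" using A by simp
        have "(\<Sum>i=1..N - 1. (norm (g i))\<^sup>2) = 0"
          using A zero N by simp
        then have "g (N - 1) = 0"
          using N by (subst (asm) sum_nonneg_eq_0_iff) auto
        then have "f (x N) \<le> f xstar"
          using penultimate_optimal_of_zero_subgradients[of d X f xstar G _ N x g] A N by blast
        moreover have "f (x (N + 1)) - f (x N) \<le> G * R * real N powr (- \<gamma>)"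
          using adagrad_last_step_increase[of d X f xstar G R N \<gamma> x g \<delta>] A zero N by simp
        moreover have "0 \<le> G * R * real N powr (- \<gamma>)" using GR by simp
        ultimately show ?thesis by linarith
      qed
      then show "f (x (N + 1)) - f xstar \<le> ?B 4 G R N"
        using zero \<gamma> A by (simp add: mult_ac)
    qed simp
  qed
qed


section \<open>Instances with prescribed energy and the optimal exponent\<close>

lemma adagrad_run_singleton:
  assumes E: "a \<in> E" and v: "v \<in> E"
  shows "adagrad_run E {a} (\<lambda>y. inner v y) G h N (\<lambda>_. a) (\<lambda>_. v)"
proof -
  have "proj {a} y = a" for y
    unfolding proj_def arg_min_on_def arg_min_def is_arg_min_def by (rule some_equality) auto
  then show ?thesis
    using E v by (auto simp: adagrad_run_def subdifferential_def inner_diff_right)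
qed

lemma subdifferential_linear:
  assumes E: "subspace E" and v: "v \<in> E" "y \<in> E"
  shows "subdifferential E (\<lambda>y. inner v y) y = {v}"
proof -
  have "g = v" if "g \<in> E" "\<forall>z\<in>E. inner v z \<ge> inner v y + inner g (z - y)" for g
  proof -
    have "y + (g - v) \<in> E" using E v that(1) by (simp add: subspace_add subspace_diff)
    then have "inner (g - v) (g - v) \<le> 0"
      using that(2) by (force simp: inner_simps)
    then show ?thesis by (metis eq_iff_diff_eq_0 inner_eq_zero_iff inner_ge_zero order_antisym)
  qed
  then show ?thesis using v by (auto simp: subdifferential_def inner_diff_right)
qed

lemma convex_problem_linear_singleton:
  assumes E: "subspace E" and v: "v \<in> E" "a \<in> E" and G: "norm v \<le> G"
  shows "convex_problem E {a} (\<lambda>y. inner v y) a G"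
  unfolding convex_problem_def
  using assms subdifferential_linear[OF E v]
  by (auto simp: is_arg_min_def convex_on_def subspace_imp_convex inner_simps)

lemma Rd_1_vector_of_norm:
  assumes "0 \<le> c"
  obtains v where "v \<in> Rd 1" "norm v = c"
proof -
  obtain v where "v \<in> Rd 1" "\<forall>i<1. coord v i = c"
    using range_of_coords[of 1 "\<lambda>_. c"] by blast
  then show ?thesis
    using that[of v] norm_Rd[of v 1] assms by simp
qed

text \<open>
  On a singleton \<open>X\<close> the iterates cannot move, so a linear function with gradient of norm \<open>0\<close> or \<open>G\<close>
  realises the exponents \<open>\<delta> = 0\<close> (for \<open>\<gamma> < 1/4\<close>) and \<open>\<delta> = 1/2\<close> (for \<open>\<gamma> \<ge> 1/4\<close>), with a gap of
  zero.
\<close>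

lemma adagrad_run_with_prescribed_energy:
  assumes \<gamma>: "\<gamma> \<in> {0<..1/2::real}" and G: "0 < G" and R: "0 < R" and N: "1 \<le> N"
  obtains X f x g where "convex_problem (Rd 1) X f 0 G" "norm (x 1 - 0) \<le> R"
    "adagrad_run (Rd 1) X f G h N x g" "f (x (N + 1)) = f (0 :: fseq)"
    "G\<^sup>2 + (\<Sum>i=1..N - 1. (norm (g i))\<^sup>2)
      = G\<^sup>2 * real N powr (2 * (1/2 * real_of_int \<lfloor>\<gamma> + 3/4\<rfloor>))"
proof -
  define c where "c = (if \<gamma> < 1/4 then 0 else G)"
  have "0 \<le> c" "c \<le> G" using G by (auto simp: c_def)
  then obtain v where v: "v \<in> Rd 1" "norm v = c"
    using Rd_1_vector_of_norm by blast
  have 0: "0 \<in> Rd 1" by (rule subspace_0[OF subspace_Rd])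
  have floor: "\<lfloor>\<gamma> + 3/4\<rfloor> = (if \<gamma> < 1/4 then 0 else 1)"
    using \<gamma> by (auto intro!: floor_unique)
  show ?thesis
  proof (rule that)
    show "convex_problem (Rd 1) {0} (\<lambda>y. inner v y) 0 G"
      by (rule convex_problem_linear_singleton[OF subspace_Rd v(1) 0]) (simp add: v \<open>c \<le> G\<close>)
    show "adagrad_run (Rd 1) {0} (\<lambda>y. inner v y) G h N (\<lambda>_. 0) (\<lambda>_. v)"
      by (rule adagrad_run_singleton[OF 0 v(1)])
    show "G\<^sup>2 + (\<Sum>i=1..N - 1. (norm v)\<^sup>2)
        = G\<^sup>2 * real N powr (2 * (1/2 * real_of_int \<lfloor>\<gamma> + 3/4\<rfloor>))"
      using N by (simp add: floor v c_def of_nat_diff algebra_simps)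
  qed (use R in auto)
qed

text \<open>
  One of the exponents \<open>\<gamma>\<close> and \<open>1/2 - \<gamma>\<close> is always at most \<open>1/4\<close>.
\<close>

lemma quarter_minimises_rate:
  fixes n c :: real
  assumes "1 \<le> n" "0 < c"
  shows "is_arg_min (\<lambda>\<gamma>. max (c / n powr \<gamma>) (c / n powr (1/2 - \<gamma>))) (\<lambda>\<gamma>. \<gamma> \<in> {0<..1/2}) (1/4)"
proof -
  have "c / n powr (1/4) \<le> c / n powr a" if "a \<le> 1/4" for a
    using assms that by (intro divide_left_mono powr_mono mult_pos_pos) auto
  then have "c / n powr (1/4) \<le> max (c / n powr \<gamma>) (c / n powr (1/2 - \<gamma>))" for \<gamma>
    by (cases "\<gamma> \<le> 1/4") (auto simp: le_max_iff_disj)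
  then show ?thesis by (auto simp: is_arg_min_linorder)
qed

theorem corollary4p3:
  shows
    "(\<forall>\<gamma>\<in>{0<..1/2::real}. \<forall>\<delta>\<in>{0..1/2::real}. \<exists>C>0.
        \<forall>(G::real) (R::real) (d::nat) X f xstar (N::nat) x g.
          G > 0 \<and> R > 0 \<and> d \<ge> 1 \<and> convex_problem (Rd d) X f xstar G \<and>
          N \<ge> 1 \<and> norm (x 1 - xstar) \<le> R \<and>
          adagrad_run (Rd d) X f G (R / real N powr \<gamma>) N x g \<and>
          G\<^sup>2 + (\<Sum>i=1..N-1. (norm (g i))\<^sup>2) = G\<^sup>2 * real N powr (2 * \<delta>)
          \<longrightarrow>
          f (x (N + 1)) - f xstar \<le>
            (if \<gamma> + \<delta> \<le> 1/2
             then C * G * R * real N powr (- \<gamma> - \<delta>) * (1 + ln (real N powr (2 * \<delta>)))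
             else C * G * R * real N powr (\<gamma> + \<delta> - 1)))
     \<and>
     (\<forall>\<gamma>\<in>{0<..1/2::real}. \<exists>C'>0.
        \<forall>(G::real) (R::real) (N::nat). G > 0 \<and> R > 0 \<and> N \<ge> 1 \<longrightarrow>
          (\<exists>d X f xstar x g.
             d \<ge> 1 \<and> convex_problem (Rd d) X f xstar G \<and>
             norm (x 1 - xstar) \<le> R \<and>
             adagrad_run (Rd d) X f G (R / real N powr \<gamma>) N x g \<and>
             (let \<delta> = 1/2 * real_of_int \<lfloor>\<gamma> + 3/4\<rfloor> in
                G\<^sup>2 + (\<Sum>i=1..N-1. (norm (g i))\<^sup>2) = G\<^sup>2 * real N powr (2 * \<delta>)) \<and>
             f (x (N + 1)) - f xstar \<le>
               C' * max (G * R / real N powr \<gamma>) (G * R / real N powr (1/2 - \<gamma>)) \<and>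
             (\<gamma> = 1/4 \<longrightarrow>
               f (x (N + 1)) - f xstar \<le> C' * (G * R / real N powr (1/4)))))
     \<and>
     (\<forall>(G::real) (R::real) (N::nat). G > 0 \<and> R > 0 \<and> N \<ge> 1 \<longrightarrow>
        is_arg_min
          (\<lambda>\<gamma>. max (G * R / real N powr \<gamma>) (G * R / real N powr (1/2 - \<gamma>)))
          (\<lambda>\<gamma>. \<gamma> \<in> {0<..1/2}) (1/4))"
    (is "(\<forall>\<gamma>\<in>_. \<forall>\<delta>\<in>_. ?rate \<gamma> \<delta>) \<and> (\<forall>\<gamma>\<in>_. ?attained \<gamma>) \<and> ?optimal")
proof (intro conjI ballI)
  fix \<gamma> \<delta> :: real assume "\<gamma> \<in> {0<..1/2}" "\<delta> \<in> {0..1/2}"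
  then show "?rate \<gamma> \<delta>"
    by (rule adagrad_rate)
next
  fix \<gamma> :: real assume \<gamma>: "\<gamma> \<in> {0<..1/2}"
  show "?attained \<gamma>"
  proof (rule exI[of _ "1::real"], intro conjI allI impI)
    fix G R :: real and N :: nat
    assume A: "G > 0 \<and> R > 0 \<and> N \<ge> 1"
    then obtain X f x g where run: "convex_problem (Rd 1) X f 0 G" "norm (x 1 - 0) \<le> R"
      "adagrad_run (Rd 1) X f G (R / real N powr \<gamma>) N x g"
      "G\<^sup>2 + (\<Sum>i=1..N - 1. (norm (g i))\<^sup>2)
        = G\<^sup>2 * real N powr (2 * (1/2 * real_of_int \<lfloor>\<gamma> + 3/4\<rfloor>))"
      and gap: "f (x (N + 1)) = f 0"
      using adagrad_run_with_prescribed_energy[OF \<gamma>, of G R N "R / real N powr \<gamma>"] by metis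
    have "f (x (N + 1)) - f 0 \<le> 1 * max (G * R / real N powr \<gamma>) (G * R / real N powr (1/2 - \<gamma>))"
      "f (x (N + 1)) - f 0 \<le> 1 * (G * R / real N powr (1/4))"
      using gap A by (auto simp: le_max_iff_disj)
    with run show "\<exists>d X f xstar x g.
             d \<ge> 1 \<and> convex_problem (Rd d) X f xstar G \<and>
             norm (x 1 - xstar) \<le> R \<and>
             adagrad_run (Rd d) X f G (R / real N powr \<gamma>) N x g \<and>
             (let \<delta> = 1/2 * real_of_int \<lfloor>\<gamma> + 3/4\<rfloor> in
                G\<^sup>2 + (\<Sum>i=1..N-1. (norm (g i))\<^sup>2) = G\<^sup>2 * real N powr (2 * \<delta>)) \<and>
             f (x (N + 1)) - f xstar \<le>
               1 * max (G * R / real N powr \<gamma>) (G * R / real N powr (1/2 - \<gamma>)) \<and>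
             (\<gamma> = 1/4 \<longrightarrow>
               f (x (N + 1)) - f xstar \<le> 1 * (G * R / real N powr (1/4)))"
      unfolding Let_def by (intro exI[of _ 1] exI[of _ X] exI[of _ f] exI[of _ 0] exI[of _ x] exI[of _ g]) blast
  qed simp
next
  show ?optimal
    using quarter_minimises_rate by auto
qed

end
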